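(* Let $E(x)=\sum_{n>0} e(n)\frac{x^n}{n!}$ be an exponential generating function, where $(e(n))_{n\ge 1}$ is a sequence of integers, and let $B(x)=\sum_{n\ge 0} b(n)x^n$ be an ordinary generating function with integer coefficients $b(n)$. Let $$G(x)=B(E(x))=\sum_{n\ge 0} g(n)\frac{x^n}{n!}$$ be their composition. Then for every prime $n$ the number $$\frac{1}{n}\bigl(g(n)-e(n)b(1)\bigr)$$ is an integer.
   Context: All generating functions are formal power series. The composition $B(E(x))$ is well defined because $E(x)$ has zero constant term, and $g(n)$ denotes $n!$ times the coefficient of $x^n$ in $B(E(x))$. *)

theory Defs
  imports "HOL-Computational_Algebra.Computational_Algebra"
begin

end

theory Submission
  imports Defs
begin

text \<open>
  The coefficient \<open>g n\<close> is the sum over \<open>k \<le> n\<close> of \<open>b k\<close> times the exponential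
  coefficient \<open>n! [x\<^sup>n] E\<^sup>k\<close>.  For \<open>k = 0\<close> this coefficient vanishes because \<open>n > 0\<close>, and
  \<open>k = 1\<close> yields exactly the term \<open>e n * b 1\<close>.  So the claim is that a prime \<open>n\<close> divides
  \<open>n! [x\<^sup>n] E\<^sup>k\<close> for every \<open>k \<ge> 2\<close>.

  Combinatorially, such a coefficient counts weighted ordered partitions of an \<open>n\<close>-set into
  \<open>k \<ge> 2\<close> nonempty blocks, and the multinomial coefficients involved are all divisible
  by the prime \<open>n\<close>.  Multinomial coefficients can be avoided by
  splitting off a single factor, \<open>E\<^sup>k = E * E\<^sup>k\<^sup>-\<^sup>1\<close>: exponential coefficients multiply by binomial
  convolution, both factors have zero constant term, and so only the binomial coefficients
  \<open>n choose i\<close> with \<open>0 < i < n\<close> survive (\<open>prime_dvd_egf_coeff_mult\<close>).  The other ingredient is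
  that the exponential coefficients of \<open>E\<^sup>k\<^sup>-\<^sup>1\<close> are again integers
  (\<open>egf_coeff_power_in_Ints\<close>).
\<close>

definition egf_coeff :: "'a::field_char_0 fps \<Rightarrow> nat \<Rightarrow> 'a" where
  "egf_coeff F n = fact n * fps_nth F n"

lemma egf_coeff_mult:
  "egf_coeff (F * H) n =
     (\<Sum>i=0..n. of_nat (n choose i) * (egf_coeff F i * egf_coeff H (n - i)))"
  unfolding egf_coeff_def fps_mult_nth sum_distrib_left
  by (intro sum.cong refl) (simp add: binomial_fact)

lemma egf_coeff_mult_in_Ints:
  assumes "\<And>i. egf_coeff F i \<in> \<int>" and "\<And>i. egf_coeff H i \<in> \<int>"
  shows "egf_coeff (F * H) n \<in> \<int>"
  unfolding egf_coeff_mult by (intro Ints_sum Ints_mult Ints_of_nat assms)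

lemma egf_coeff_power_in_Ints:
  assumes "\<And>i. egf_coeff F i \<in> \<int>"
  shows "egf_coeff (F ^ k) n \<in> \<int>"
proof (induction k arbitrary: n)
  case 0
  show ?case by (simp add: egf_coeff_def)
next
  case (Suc k)
  then show ?case by (simp add: egf_coeff_mult_in_Ints assms)
qed

text \<open>
  In the binomial convolution for \<open>p\<close> the two outer terms, the only ones whose binomial
  coefficient is not a multiple of \<open>p\<close>, contain a constant term as a factor.
\<close>
lemma prime_dvd_egf_coeff_mult:
  assumes p: "prime p"
    and F: "\<And>i. egf_coeff F i \<in> \<int>" "fps_nth F 0 = 0"
    and H: "\<And>i. egf_coeff H i \<in> \<int>" "fps_nth H 0 = 0"
  shows "egf_coeff (F * H) p / of_nat p \<in> \<int>"
proof -
  have "of_nat (p choose i) * (egf_coeff F i * egf_coeff H (p - i)) / of_nat p \<in> \<int>"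
    if "i \<le> p" for i
  proof (cases "i = 0 \<or> i = p")
    case True
    then show ?thesis using F(2) H(2) by (auto simp: egf_coeff_def)
  next
    case False
    then have "p dvd (p choose i)"
      using that p by (intro dvd_choose_prime) auto
    then obtain c where c: "p choose i = p * c" ..
    have "of_nat c * (egf_coeff F i * egf_coeff H (p - i)) \<in> \<int>"
      by (intro Ints_mult Ints_of_nat F(1) H(1))
    then show ?thesis
      using prime_gt_0_nat[OF p] by (simp add: c)
  qed
  then show ?thesis
    unfolding egf_coeff_mult sum_divide_distrib by (intro Ints_sum) auto
qed

lemma prime_dvd_egf_coeff_power:
  assumes p: "prime p" and F: "\<And>i. egf_coeff F i \<in> \<int>" "fps_nth F 0 = 0" and k: "2 \<le> k"
  shows "egf_coeff (F ^ k) p / of_nat p \<in> \<int>"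
proof -
  obtain m where m: "k = Suc (Suc m)"
    using k by (metis add_2_eq_Suc le_Suc_ex)
  have "fps_nth (F ^ Suc m) 0 = 0"
    using F(2) by simp
  then have "egf_coeff (F * F ^ Suc m) p / of_nat p \<in> \<int>"
    by (intro prime_dvd_egf_coeff_mult p F egf_coeff_power_in_Ints)
  then show ?thesis
    by (simp add: m)
qed

theorem theorem8:
  fixes e b :: "nat \<Rightarrow> int"
    and E B G :: "rat fps"
    and g :: "nat \<Rightarrow> rat"
    and n :: nat
  assumes E: "E = Abs_fps (\<lambda>k. if k = 0 then 0 else of_int (e k) / fact k)"
    and B: "B = Abs_fps (\<lambda>k. of_int (b k))"
    and G: "G = fps_compose B E"
    and g: "\<And>k. g k = fact k * fps_nth G k"
    and n: "prime n"
  shows "(1 / of_nat n) * (g n - of_int (e n) * of_int (b 1)) \<in> \<int>"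
proof -
  have n2: "2 \<le> n"
    using n by (rule prime_ge_2_nat)
  have E_Ints: "egf_coeff E i \<in> \<int>" for i
    by (simp add: E egf_coeff_def)
  have E_0: "fps_nth E 0 = 0"
    by (simp add: E)
  have "g n = (\<Sum>k=0..n. of_int (b k) * egf_coeff (E ^ k) n)"
    by (simp add: g G B fps_compose_nth egf_coeff_def sum_distrib_left mult_ac)
  also have "{0..n} = insert 0 (insert 1 {2..n})"
    using n2 by auto
  also have "(\<Sum>k\<in>\<dots>. of_int (b k) * egf_coeff (E ^ k) n) =
      of_int (e n) * of_int (b 1) + (\<Sum>k=2..n. of_int (b k) * egf_coeff (E ^ k) n)"
    using n2 by (simp add: egf_coeff_def E)
  finally have "(1 / of_nat n) * (g n - of_int (e n) * of_int (b 1)) =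
      (\<Sum>k=2..n. of_int (b k) * (egf_coeff (E ^ k) n / of_nat n))"
    by (simp add: sum_divide_distrib)
  also have "\<dots> \<in> \<int>"
    by (intro Ints_sum Ints_mult Ints_of_int prime_dvd_egf_coeff_power n E_Ints E_0) auto
  finally show ?thesis .
qed

end
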